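(* Let $n,s,k,\nu\ge1$ be integers, $m=n+1$, $h>0$, $\bar H>0$, $y_0\in\mathbb{R}^m$, let $f:\mathbb{R}^n\to\mathbb{R}^n$ be continuously differentiable, and let $g:\mathbb{R}^n\to\mathbb{R}$ be a polynomial of degree at most $\nu$, where $$\nu\le\frac{2k}{s}.$$ Let $u_\alpha=\begin{pmatrix}x_\alpha\\ \omega_\alpha\end{pmatrix}$ and $\alpha\in\mathbb{R}$ be the polynomial and the scalar of one step, with stepsize $h$ and starting at $y_0$, of the EPHBVM$(k,s)$ method defined in the context, and let $y_1$ be the resulting new approximation. Then the quadratures are exact: $$\hat g_0=\int_0^1\nabla g(x_\alpha(ch))\,\mathrm{d}c,\qquad \hat\gamma_j(u_\alpha)=\int_0^1P_j(\xi)\nabla H(u_\alpha(\xi h))\,\mathrm{d}\xi,\quad j=0,\dots,s-1.$$ Consequently, $H(y_1)=H(y_0)$.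
   Context: Let $D=\{x\in\mathbb{R}^n:\nabla g(x)^\top f(x)\ne0\}$. For $y=\begin{pmatrix}x\\ \omega\end{pmatrix}$ with $x\in\mathbb{R}^n$, $\omega\in\mathbb{R}$, put $H(y)=g(x)-\omega+\bar H$, so that $\nabla H(y)=\begin{pmatrix}\nabla g(x)\\-1\end{pmatrix}$. For $y\in D\times\mathbb{R}$ put $$G(y)=\begin{pmatrix}\dfrac{f(x)}{\nabla g(x)^\top f(x)}\\[2mm]1\end{pmatrix},\qquad B(y)=\frac{G(y)\nabla H(y)^\top-\nabla H(y)G(y)^\top}{\|\nabla H(y)\|_2^2}.$$ $P_0,P_1,P_2,\dots$ are the orthonormal (shifted) Legendre polynomials on $[0,1]$: $P_i$ is a polynomial of degree $i$ and $\int_0^1P_i(\xi)P_j(\xi)\,\mathrm{d}\xi=\delta_{ij}$ (in particular $P_0\equiv1$). $(c_\ell,b_\ell)$, $\ell=1,\dots,k$, are the abscissae and weights of the $k$-point Gauss–Legendre quadrature formula on $[0,1]$ (order $2k$, i.e. exact for polynomials of degree at most $2k-1$). $e_m\in\mathbb{R}^m$ is the last unit vector. One step of the EPHBVM$(k,s)$ method: a pair $(u_\alpha,\alpha)$, where $\alpha\in\mathbb{R}$ and $u_\alpha=\begin{pmatrix}x_\alpha\\ \omega_\alpha\end{pmatrix}:[0,h]\to\mathbb{R}^n\times\mathbb{R}$ is a polynomial path of degree at most $s$ with $x_\alpha(c_\ell h)\in D$ for $\ell=1,\dots,k$ and with $\hat g_0\neq0$ (below), satisfying $u_\alpha(0)=y_0$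 and $$\dot u_\alpha(ch)=\sum_{i,j=0}^{s-1}P_i(c)\,\hat\rho_{ij}(u_\alpha)\,\hat\gamma_j(u_\alpha)-\alpha\begin{pmatrix}\hat d_0\\1\end{pmatrix},\qquad c\in[0,1],$$ where $$\hat g_0=\sum_{\ell=1}^kb_\ell\nabla g(x_\alpha(c_\ell h)),\qquad \hat d_0=\frac{\hat g_0}{\|\hat g_0\|_2^2},$$ $$\hat\gamma_j(u_\alpha)=\sum_{\ell=1}^kb_\ell P_j(c_\ell)\nabla H(u_\alpha(c_\ell h)),\qquad \hat\rho_{ij}(u_\alpha)=\sum_{\ell=1}^kb_\ell P_i(c_\ell)P_j(c_\ell)B(u_\alpha(c_\ell h)),\quad i,j=0,\dots,s-1,$$ $$\alpha=\sum_{j=0}^{s-1}e_m^\top\hat\rho_{0j}(u_\alpha)\hat\gamma_j(u_\alpha)-1.$$ The new approximation is $$y_1:=u_\alpha(h)=y_0+h\sum_{j=0}^{s-1}\hat\rho_{0j}(u_\alpha)\hat\gamma_j(u_\alpha)-\alpha h\begin{pmatrix}\hat d_0\\1\end{pmatrix}.$$ The dot denotes the derivative of a path with respect to its argument $t=ch\in[0,h]$. *)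

theory Defs
  imports "HOL-Analysis.Analysis" "HOL-Computational_Algebra.Polynomial"
begin

definition grad :: "('a::real_inner \<Rightarrow> real) \<Rightarrow> 'a \<Rightarrow> 'a" where
  "grad F x = (THE D. GDERIV F x :> D)"

definition continuously_differentiable ::
    "('a::real_normed_vector \<Rightarrow> 'b::real_normed_vector) \<Rightarrow> bool" where
  "continuously_differentiable F \<longleftrightarrow>
     (\<exists>F' :: 'a \<Rightarrow> 'a \<Rightarrow>\<^sub>L 'b.
        (\<forall>x. (F has_derivative blinfun_apply (F' x)) (at x)) \<and> continuous_on UNIV F')"

(* Total degree; the index set of multi-indices is finite since 'n is finite. *)
definition polynomial_of_degree_le :: "nat \<Rightarrow> (real ^ 'n \<Rightarrow> real) \<Rightarrow> bool" where
  "polynomial_of_degree_le d g \<longleftrightarrow>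
     (\<exists>a :: ('n \<Rightarrow> nat) \<Rightarrow> real. \<forall>x.
        g x = (\<Sum>\<kappa> | (\<Sum>i\<in>UNIV. \<kappa> i) \<le> d. a \<kappa> * (\<Prod>i\<in>UNIV. (x $ i) ^ \<kappa> i)))"

lemma finite_multi_indices: "finite {\<kappa> :: 'n::finite \<Rightarrow> nat. (\<Sum>i\<in>UNIV. \<kappa> i) \<le> d}"
proof (rule finite_subset)
  show "{\<kappa> :: 'n \<Rightarrow> nat. (\<Sum>i\<in>UNIV. \<kappa> i) \<le> d} \<subseteq> (UNIV \<rightarrow>\<^sub>E {..d})"
  proof safe
    fix \<kappa> :: "'n \<Rightarrow> nat" and i assume "(\<Sum>i\<in>UNIV. \<kappa> i) \<le> d"
    then show "\<kappa> i \<le> d"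
      using member_le_sum[of i UNIV \<kappa>] by simp
  qed auto
  show "finite ((UNIV :: 'n set) \<rightarrow>\<^sub>E {..d})"
    by (intro finite_PiE) auto
qed

definition polynomial_path_on :: "real set \<Rightarrow> nat \<Rightarrow> (real \<Rightarrow> 'a::real_vector) \<Rightarrow> bool" where
  "polynomial_path_on T d u \<longleftrightarrow> (\<exists>a. \<forall>t\<in>T. u t = (\<Sum>i\<le>d. t ^ i *\<^sub>R a i))"

(* Orthonormality fixes each P i only up to sign; P 0 = 1 is the normalisation of the sign
   of P 0, and the signs of the other P i are left free. *)
definition orthonormal_legendre :: "(nat \<Rightarrow> real poly) \<Rightarrow> bool" where
  "orthonormal_legendre P \<longleftrightarrow>
     (\<forall>i. degree (P i) = i) \<and>
     (\<forall>i j. integral {0..1} (\<lambda>\<xi>. poly (P i) \<xi> * poly (P j) \<xi>) = (if i = j then 1 else 0)) \<and>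
     P 0 = 1"

(* Abscissae: the k zeros of the shifted Legendre polynomial of degree k.
   Weights: the integrals of the associated Lagrange basis polynomials. *)
definition gauss_legendre ::
    "(nat \<Rightarrow> real poly) \<Rightarrow> nat \<Rightarrow> (nat \<Rightarrow> real) \<Rightarrow> (nat \<Rightarrow> real) \<Rightarrow> bool" where
  "gauss_legendre P k c b \<longleftrightarrow>
     inj_on c {1..k} \<and>
     (\<forall>l\<in>{1..k}. c l \<in> {0..1} \<and> poly (P k) (c l) = 0 \<and>
        b l = integral {0..1} (\<lambda>\<xi>. \<Prod>r\<in>{1..k} - {l}. (\<xi> - c r) / (c l - c r)))"

definition quadrature ::
    "nat \<Rightarrow> (nat \<Rightarrow> real) \<Rightarrow> (nat \<Rightarrow> real) \<Rightarrow> (real \<Rightarrow> 'a::real_vector) \<Rightarrow> 'a" where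
  "quadrature k c b F = (\<Sum>l=1..k. b l *\<^sub>R F (c l))"

(* The augmented space R^m, m = n + 1, is rendered as (real ^ 'n) \<times> real with y = (x, \<omega>), so that
   e_m is (0, 1). An m \<times> m matrix is rendered as the linear map it induces; in particular
   the matrix a b^T becomes \<lambda>v. (b \<bullet> v) *\<^sub>R a. *)

definition aug_H :: "(real ^ 'n \<Rightarrow> real) \<Rightarrow> real \<Rightarrow> (real ^ 'n) \<times> real \<Rightarrow> real" where
  "aug_H g Hbar y = g (fst y) - snd y + Hbar"

definition dom_D :: "(real ^ 'n \<Rightarrow> real ^ 'n) \<Rightarrow> (real ^ 'n \<Rightarrow> real) \<Rightarrow> (real ^ 'n) set" where
  "dom_D f g = {x. grad g x \<bullet> f x \<noteq> 0}"

definition aug_G :: "(real ^ 'n \<Rightarrow> real ^ 'n) \<Rightarrow> (real ^ 'n \<Rightarrow> real) \<Rightarrow>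
    (real ^ 'n) \<times> real \<Rightarrow> (real ^ 'n) \<times> real" where
  "aug_G f g y = (f (fst y) /\<^sub>R (grad g (fst y) \<bullet> f (fst y)), 1)"

definition aug_B :: "(real ^ 'n \<Rightarrow> real ^ 'n) \<Rightarrow> (real ^ 'n \<Rightarrow> real) \<Rightarrow> real \<Rightarrow>
    (real ^ 'n) \<times> real \<Rightarrow> (real ^ 'n) \<times> real \<Rightarrow> (real ^ 'n) \<times> real" where
  "aug_B f g Hbar y v =
     ((grad (aug_H g Hbar) y \<bullet> v) *\<^sub>R aug_G f g y - (aug_G f g y \<bullet> v) *\<^sub>R grad (aug_H g Hbar) y)
       /\<^sub>R (norm (grad (aug_H g Hbar) y))\<^sup>2"

definition g_hat0 :: "nat \<Rightarrow> (nat \<Rightarrow> real) \<Rightarrow> (nat \<Rightarrow> real) \<Rightarrow> (real ^ 'n \<Rightarrow> real) \<Rightarrow> real \<Rightarrow>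
    (real \<Rightarrow> (real ^ 'n) \<times> real) \<Rightarrow> real ^ 'n" where
  "g_hat0 k c b g h u = quadrature k c b (\<lambda>\<xi>. grad g (fst (u (\<xi> * h))))"

definition d_hat0 :: "nat \<Rightarrow> (nat \<Rightarrow> real) \<Rightarrow> (nat \<Rightarrow> real) \<Rightarrow> (real ^ 'n \<Rightarrow> real) \<Rightarrow> real \<Rightarrow>
    (real \<Rightarrow> (real ^ 'n) \<times> real) \<Rightarrow> real ^ 'n" where
  "d_hat0 k c b g h u = g_hat0 k c b g h u /\<^sub>R (norm (g_hat0 k c b g h u))\<^sup>2"

definition gamma_hat :: "(nat \<Rightarrow> real poly) \<Rightarrow> nat \<Rightarrow> (nat \<Rightarrow> real) \<Rightarrow> (nat \<Rightarrow> real) \<Rightarrow>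
    (real ^ 'n \<Rightarrow> real) \<Rightarrow> real \<Rightarrow> real \<Rightarrow> (real \<Rightarrow> (real ^ 'n) \<times> real) \<Rightarrow> nat \<Rightarrow> (real ^ 'n) \<times> real" where
  "gamma_hat P k c b g Hbar h u j =
     quadrature k c b (\<lambda>\<xi>. poly (P j) \<xi> *\<^sub>R grad (aug_H g Hbar) (u (\<xi> * h)))"

definition rho_hat :: "(nat \<Rightarrow> real poly) \<Rightarrow> nat \<Rightarrow> (nat \<Rightarrow> real) \<Rightarrow> (nat \<Rightarrow> real) \<Rightarrow>
    (real ^ 'n \<Rightarrow> real ^ 'n) \<Rightarrow> (real ^ 'n \<Rightarrow> real) \<Rightarrow> real \<Rightarrow> real \<Rightarrow> (real \<Rightarrow> (real ^ 'n) \<times> real) \<Rightarrow>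
    nat \<Rightarrow> nat \<Rightarrow> (real ^ 'n) \<times> real \<Rightarrow> (real ^ 'n) \<times> real" where
  "rho_hat P k c b f g Hbar h u i j v =
     quadrature k c b (\<lambda>\<xi>. (poly (P i) \<xi> * poly (P j) \<xi>) *\<^sub>R aug_B f g Hbar (u (\<xi> * h)) v)"

definition ephbvm_step :: "(nat \<Rightarrow> real poly) \<Rightarrow> nat \<Rightarrow> nat \<Rightarrow> (nat \<Rightarrow> real) \<Rightarrow> (nat \<Rightarrow> real) \<Rightarrow>
    (real ^ 'n \<Rightarrow> real ^ 'n) \<Rightarrow> (real ^ 'n \<Rightarrow> real) \<Rightarrow> real \<Rightarrow> real \<Rightarrow> (real ^ 'n) \<times> real \<Rightarrow>
    (real \<Rightarrow> (real ^ 'n) \<times> real) \<Rightarrow> real \<Rightarrow> bool" where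
  "ephbvm_step P k s c b f g Hbar h y0 u \<alpha> \<longleftrightarrow>
     polynomial_path_on {0..h} s u \<and>
     (\<forall>l\<in>{1..k}. fst (u (c l * h)) \<in> dom_D f g) \<and>
     g_hat0 k c b g h u \<noteq> 0 \<and>
     u 0 = y0 \<and>
     (\<forall>\<xi>\<in>{0..1}.
        (u has_vector_derivative
           (\<Sum>i<s. \<Sum>j<s. poly (P i) \<xi> *\<^sub>R
              rho_hat P k c b f g Hbar h u i j (gamma_hat P k c b g Hbar h u j))
           - \<alpha> *\<^sub>R (d_hat0 k c b g h u, 1))
        (at (\<xi> * h) within {0..h})) \<and>
     \<alpha> = (\<Sum>j<s. (0, 1) \<bullet>
           rho_hat P k c b f g Hbar h u 0 j (gamma_hat P k c b g Hbar h u j)) - 1"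

end

theory Submission imports Defs begin

text \<open>Along the path every component of \<open>\<nabla>g(x(ch))\<close> is a polynomial in \<open>c\<close> of degree at most
  \<open>(\<nu> - 1) s\<close>; times \<open>P\<^sub>j\<close> with \<open>j < s\<close> the degree is at most \<open>\<nu> s - 1 \<le> 2 k - 1\<close>, so the Gauss
  formula integrates it exactly. Hence \<open>H(y\<^sub>1) - H(y\<^sub>0)\<close>, the integral of \<open>\<nabla>H(u) \<bullet> u'\<close>, equals
  \<open>h (\<Sum>\<^sub>i\<^sub>j \<gamma>\<^sub>i \<bullet> \<rho>\<^sub>i\<^sub>j \<gamma>\<^sub>j - \<alpha> \<gamma>\<^sub>0 \<bullet> (d\<^sub>0, 1))\<close>. The double sum vanishes because
  \<open>\<rho>\<^sub>i\<^sub>j = \<rho>\<^sub>j\<^sub>i\<close> is skew-symmetric, and \<open>\<gamma>\<^sub>0 = (g\<^sub>0, -1)\<close> is orthogonal to \<open>(d\<^sub>0, 1)\<close> because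
  \<open>g\<^sub>0 \<bullet> d\<^sub>0 = 1\<close>.\<close>

section \<open>Exactness of Gauss--Legendre quadrature\<close>

lemma poly_integrable: "(\<lambda>x. poly p x) integrable_on {a..b::real}"
  by (intro integrable_continuous_real continuous_intros)

text \<open>Induction on \<open>m\<close>: subtracting the multiple \<open>a\<close> of
  \<open>P m\<close> kills the coefficient of degree \<open>m\<close>, and \<open>P m\<close> itself
  is orthogonal to \<open>P k\<close> because \<open>m < k\<close>. Bounding the degree by vanishing
  coefficients makes the base case \<open>m = 0\<close> say \<open>q = 0\<close>, which a bound on
  \<open>degree q\<close> could not express.\<close>

lemma legendre_orthogonal_lower_degree:
  assumes "orthonormal_legendre P" and "m \<le> k" and "\<And>i. i \<ge> m \<Longrightarrow> coeff q i = 0"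
  shows "integral {0..1} (poly (q * P k)) = 0"
  using assms(2,3)
proof (induction m arbitrary: q)
  case 0
  then have "q = 0" by (intro poly_eqI) simp
  then show ?case by (simp add: zero_poly.rep_eq)
next
  case (Suc m)
  have deg: "degree (P m) = m"
    and orth: "integral {0..1} (\<lambda>x. poly (P m) x * poly (P k) x) = (if m = k then 1 else 0)"
    and P0: "P 0 = 1"
    using assms(1) unfolding orthonormal_legendre_def by blast+
  \<comment> \<open>A positive degree excludes the zero polynomial; degree 0 does not, so there the
    normalisation \<open>P 0 = 1\<close> is used.\<close>
  have lead: "coeff (P m) m \<noteq> 0"
  proof (cases "m = 0")
    case False
    then have "P m \<noteq> 0" using deg by (intro notI) simp
    from leading_coeff_neq_0[OF this] show ?thesis unfolding deg .
  qed (simp add: P0)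
  define a where "a = coeff q m / coeff (P m) m"
  define r where "r = q - smult a (P m)"
  have "coeff r i = 0" if "i \<ge> m" for i
    using that lead Suc.prems(2)[of i] coeff_eq_0[of "P m" i] deg
    by (cases "i = m") (auto simp: r_def a_def)
  then have IH: "integral {0..1} (poly (r * P k)) = 0"
    using Suc.prems(1) by (intro Suc.IH) auto
  have "poly (q * P k) = (\<lambda>x. poly (r * P k) x + a * poly (P m * P k) x)"
    by (auto simp: r_def algebra_simps)
  then have "integral {0..1} (poly (q * P k)) =
      integral {0..1} (poly (r * P k)) + a * integral {0..1} (poly (P m * P k))"
    by (simp only: integral_add[OF poly_integrable integrable_on_mult_right[OF poly_integrable]]
        integral_mult_right)
  also have "integral {0..1} (poly (P m * P k)) = 0"
    using orth Suc.prems(1) by (simp add: poly_mult[abs_def])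
  finally show ?case unfolding IH by simp
qed

text \<open>Both sides are polynomials of degree below \<open>card I\<close> that agree at the
  \<open>card I\<close> distinct nodes. The basis polynomials are exactly those whose integrals
  define the Gauss weights.\<close>

lemma lagrange_interpolation:
  fixes p :: "real poly"
  assumes "finite I" and inj: "inj_on c I" and "degree p < card I"
  shows "poly p x = (\<Sum>l\<in>I. poly p (c l) * (\<Prod>r\<in>I - {l}. (x - c r) / (c l - c r)))"
proof -
  define L where "L l = (\<Prod>r\<in>I - {l}. smult (1 / (c l - c r)) [:- c r, 1:])" for l
  have L: "poly (L l) x = (\<Prod>r\<in>I - {l}. (x - c r) / (c l - c r))" for l x
    by (simp add: L_def poly_prod diff_divide_distrib)
  have degL: "degree (L l) < card I" if "l \<in> I" for l
  proof -
    have "degree (L l) \<le> (\<Sum>r\<in>I - {l}. degree (smult (1 / (c l - c r)) [:- c r, 1:]))"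
      unfolding L_def using degree_prod_sum_le[of "I - {l}"] \<open>finite I\<close> unfolding o_def by blast
    also have "\<dots> \<le> (\<Sum>r\<in>I - {l}. 1)"
      by (intro sum_mono) simp
    also have "\<dots> < card I"
      using that \<open>finite I\<close> card_gt_0_iff[of I] by auto
    finally show ?thesis .
  qed
  have Lc: "poly (L l) (c m) = (if m = l then 1 else 0)" if "l \<in> I" "m \<in> I" for l m
  proof (cases "m = l")
    case True
    then show ?thesis
      unfolding L using that inj_on_eq_iff[OF inj] by (auto intro!: prod.neutral split: if_splits)
  next
    case False
    then show ?thesis
      using that \<open>finite I\<close> unfolding L by (auto intro!: prod_zero)
  qed
  define q where "q = (\<Sum>l\<in>I. smult (poly p (c l)) (L l))"
  have "p = q"
  proof (rule poly_eqI_degree[of "c ` I"])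
    have card: "card (c ` I) = card I" using inj by (rule card_image)
    show "card (c ` I) > degree p" using assms card by simp
    \<comment> \<open>The degree bound for sums is non-strict, hence \<open>card I - 1\<close>; it
      becomes strict again because \<open>degree p < card I\<close> forces
      \<open>card I > 0\<close>.\<close>
    have "degree q \<le> card I - 1"
      unfolding q_def
    proof (intro degree_sum_le \<open>finite I\<close>)
      fix l assume "l \<in> I"
      from degL[OF this] show "degree (smult (poly p (c l)) (L l)) \<le> card I - 1"
        using degree_smult_le[of "poly p (c l)" "L l"] by linarith
    qed
    then show "card (c ` I) > degree q" using assms card by simp
    fix x assume "x \<in> c ` I"
    then obtain m where m: "m \<in> I" "x = c m" by auto
    have "poly q x = (\<Sum>l\<in>I. if m = l then poly p (c l) else 0)"
      unfolding q_def poly_sum using m Lc by (intro sum.cong) auto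
    then show "poly p x = poly q x"
      using m \<open>finite I\<close> by simp
  qed
  then have "poly p x = poly q x" by simp
  then show ?thesis by (simp add: q_def poly_sum L)
qed

lemma gauss_legendre_exact:
  assumes "orthonormal_legendre P" and gl: "gauss_legendre P k c b" and deg: "degree p < 2 * k"
  shows "(poly p has_integral quadrature k c b (poly p)) {0..1}"
proof -
  \<comment> \<open>\<open>q P\<^sub>k\<close> has integral 0 by orthogonality and quadrature 0 since the nodes are zeros of \<open>P\<^sub>k\<close>.\<close>
  define q where "q = p div P k"
  define r where "r = p mod P k"
  have degP: "degree (P k) = k" using assms(1) by (simp add: orthonormal_legendre_def)
  have k: "k > 0" using deg by simp
  then have P0: "P k \<noteq> 0" using degP by auto
  have p: "p = q * P k + r" by (simp add: q_def r_def)
  have degr: "degree r < k"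
    using degree_mod_less[OF P0, of p] degP k by (auto simp: r_def)
  \<comment> \<open>\<open>q * P k = p - r\<close> has degree below \<open>2 * k\<close>, and
    \<open>P k\<close> accounts for \<open>k\<close> of it, so \<open>q\<close> has degree below
    \<open>k\<close>.\<close>
  have "coeff q i = 0" if "i \<ge> k" for i
  proof (cases "q = 0")
    case False
    have "degree (q * P k) < 2 * k"
      using degree_diff_less[OF deg, of r] degr p by simp
    then have "degree q < k"
      using False P0 degP by (simp add: degree_mult_eq)
    then show ?thesis using that by (simp add: coeff_eq_0)
  qed simp
  then have orth: "integral {0..1} (poly (q * P k)) = 0"
    by (rule legendre_orthogonal_lower_degree[OF assms(1) order.refl])
  have roots: "poly p (c l) = poly r (c l)" if "l \<in> {1..k}" for l
    using gl that by (subst p) (simp add: gauss_legendre_def)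
  \<comment> \<open>The remainder has degree below \<open>k\<close>, so it equals its interpolant at
    the \<open>k\<close> nodes; integrating the interpolant term by term turns the basis polynomials
    into the weights \<open>b l\<close>.\<close>
  have lag: "poly r x = (\<Sum>l=1..k. poly r (c l) * (\<Prod>i\<in>{1..k} - {l}. (x - c i) / (c l - c i)))" for x
    using lagrange_interpolation[of "{1..k}" c r x] gl degr by (simp add: gauss_legendre_def)
  have "((\<lambda>x. \<Sum>l=1..k. poly r (c l) * (\<Prod>i\<in>{1..k} - {l}. (x - c i) / (c l - c i)))
      has_integral (\<Sum>l=1..k. poly r (c l) * b l)) {0..1}"
  proof (intro has_integral_sum has_integral_mult_right)
    fix l assume l: "l \<in> {1..k}"
    have "continuous_on {0..1} (\<lambda>x. \<Prod>i\<in>{1..k} - {l}. (x - c i) / (c l - c i))"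
      unfolding divide_inverse by (intro continuous_intros)
    from integrable_integral[OF integrable_continuous_real[OF this]]
    show "((\<lambda>x. \<Prod>i\<in>{1..k} - {l}. (x - c i) / (c l - c i)) has_integral b l) {0..1}"
      using gl l by (simp add: gauss_legendre_def)
  qed simp
  then have "(poly r has_integral (\<Sum>l=1..k. poly r (c l) * b l)) {0..1}"
    by (simp only: lag[symmetric, abs_def])
  moreover have "(poly (q * P k) has_integral 0) {0..1}"
    using integrable_integral[OF poly_integrable, of "q * P k" 0 1] unfolding orth .
  ultimately have "((\<lambda>x. poly (q * P k) x + poly r x) has_integral
      0 + (\<Sum>l=1..k. poly r (c l) * b l)) {0..1}"
    by (intro has_integral_add)
  moreover have "(\<lambda>x. poly (q * P k) x + poly r x) = poly p"
    unfolding p[symmetric] poly_add[abs_def, symmetric] ..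
  moreover have "0 + (\<Sum>l=1..k. poly r (c l) * b l) = quadrature k c b (poly p)"
    using roots by (simp add: quadrature_def mult.commute)
  ultimately show ?thesis by simp
qed

section \<open>Polynomial paths\<close>

lemma polynomial_path_on_cong:
  assumes "\<And>t. t \<in> T \<Longrightarrow> u t = v t"
  shows "polynomial_path_on T d u \<longleftrightarrow> polynomial_path_on T d v"
  using assms by (simp add: polynomial_path_on_def)

lemma polynomial_path_on_mono:
  assumes "polynomial_path_on T d u" and "d \<le> e"
  shows "polynomial_path_on T e u"
proof -
  obtain a where a: "\<And>t. t \<in> T \<Longrightarrow> u t = (\<Sum>i\<le>d. t ^ i *\<^sub>R a i)"
    using assms(1) by (auto simp: polynomial_path_on_def)
  have "(\<Sum>i\<le>d. t ^ i *\<^sub>R a i) = (\<Sum>i\<le>e. t ^ i *\<^sub>R (if i \<le> d then a i else 0))" for t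
    using assms(2) by (intro sum.mono_neutral_cong_left) auto
  then show ?thesis
    unfolding polynomial_path_on_def using a by (intro exI[of _ "\<lambda>i. if i \<le> d then a i else 0"]) simp
qed

lemma polynomial_path_on_poly: "polynomial_path_on T (degree p) (poly p)"
  unfolding polynomial_path_on_def poly_altdef by (auto intro!: exI[of _ "coeff p"] simp: mult.commute)

text \<open>A bridge to the type \<open>real poly\<close>, so that degree bounds for products of
  scalar paths come from the algebra of polynomials.\<close>

lemma polynomial_path_on_real_iff:
  "polynomial_path_on T d u \<longleftrightarrow> (\<exists>p. degree p \<le> d \<and> (\<forall>t\<in>T. u t = poly p t))"
proof
  assume "polynomial_path_on T d u"
  then obtain a where "\<And>t. t \<in> T \<Longrightarrow> u t = (\<Sum>i\<le>d. t ^ i *\<^sub>R a i)"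
    by (auto simp: polynomial_path_on_def)
  moreover have "degree (\<Sum>i\<le>d. monom (a i) i) \<le> d"
    by (intro degree_sum_le) (auto intro: order.trans[OF degree_monom_le])
  ultimately show "\<exists>p. degree p \<le> d \<and> (\<forall>t\<in>T. u t = poly p t)"
    by (intro exI[of _ "\<Sum>i\<le>d. monom (a i) i"]) (simp add: poly_sum poly_monom mult.commute)
next
  assume "\<exists>p. degree p \<le> d \<and> (\<forall>t\<in>T. u t = poly p t)"
  then obtain p where "degree p \<le> d" "\<And>t. t \<in> T \<Longrightarrow> u t = poly p t" by auto
  then show "polynomial_path_on T d u"
    using polynomial_path_on_mono[OF polynomial_path_on_poly[of T p]]
    by (simp add: polynomial_path_on_cong[of T u "poly p"])
qed

lemma polynomial_path_on_linear:
  assumes "linear F" and "polynomial_path_on T d u"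
  shows "polynomial_path_on T d (\<lambda>t. F (u t))"
proof -
  obtain a where "\<And>t. t \<in> T \<Longrightarrow> u t = (\<Sum>i\<le>d. t ^ i *\<^sub>R a i)"
    using assms(2) by (auto simp: polynomial_path_on_def)
  then show ?thesis
    unfolding polynomial_path_on_def
    by (intro exI[of _ "\<lambda>i. F (a i)"]) (simp add: linear_sum[OF assms(1)] linear_scale[OF assms(1)])
qed

lemma polynomial_path_on_sum:
  assumes "\<And>i. i \<in> I \<Longrightarrow> polynomial_path_on T d (u i)"
  shows "polynomial_path_on T d (\<lambda>t. \<Sum>i\<in>I. u i t)"
proof -
  obtain a where "\<And>i t. i \<in> I \<Longrightarrow> t \<in> T \<Longrightarrow> u i t = (\<Sum>j\<le>d. t ^ j *\<^sub>R a i j)"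
    using assms unfolding polynomial_path_on_def by metis
  then have "(\<Sum>i\<in>I. u i t) = (\<Sum>j\<le>d. t ^ j *\<^sub>R (\<Sum>i\<in>I. a i j))" if "t \<in> T" for t
    using that by (simp add: scaleR_sum_right) (rule sum.swap)
  then show ?thesis
    unfolding polynomial_path_on_def by (intro exI[of _ "\<lambda>j. \<Sum>i\<in>I. a i j"]) simp
qed

text \<open>With \<open>r\<close> written as a polynomial \<open>p\<close>, each term of the product
  is the scalar polynomial \<open>p * monom 1 i\<close> followed by the linear map that scales the
  fixed vector \<open>a i\<close>; no convolution of coefficients is needed.\<close>

lemma polynomial_path_on_scaleR:
  assumes "polynomial_path_on T d r" and "polynomial_path_on T e u"
  shows "polynomial_path_on T (d + e) (\<lambda>t. r t *\<^sub>R u t)"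
proof -
  obtain p where p: "degree p \<le> d" "\<And>t. t \<in> T \<Longrightarrow> r t = poly p t"
    using assms(1) by (auto simp: polynomial_path_on_real_iff)
  obtain a where a: "\<And>t. t \<in> T \<Longrightarrow> u t = (\<Sum>i\<le>e. t ^ i *\<^sub>R a i)"
    using assms(2) by (auto simp: polynomial_path_on_def)
  have "polynomial_path_on T (d + e) (\<lambda>t. \<Sum>i\<le>e. poly (p * monom 1 i) t *\<^sub>R a i)"
  proof (intro polynomial_path_on_sum polynomial_path_on_linear[of "\<lambda>r. r *\<^sub>R a _"])
    fix i assume "i \<in> {..e}"
    then have "degree (p * monom 1 i) \<le> d + e"
      using p(1) by (intro order.trans[OF degree_mult_le]) (simp add: degree_monom_eq)
    then show "polynomial_path_on T (d + e) (poly (p * monom 1 i))"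
      by (rule polynomial_path_on_mono[OF polynomial_path_on_poly])
  qed (auto intro!: linearI simp: scaleR_add_left)
  moreover have "r t *\<^sub>R u t = (\<Sum>i\<le>e. poly (p * monom 1 i) t *\<^sub>R a i)" if "t \<in> T" for t
    using that by (simp add: a p(2) scaleR_sum_right poly_monom)
  ultimately show ?thesis by (simp cong: polynomial_path_on_cong)
qed

lemma polynomial_path_on_mult:
  fixes u v :: "real \<Rightarrow> real"
  assumes "polynomial_path_on T d u" and "polynomial_path_on T e v"
  shows "polynomial_path_on T (d + e) (\<lambda>t. u t * v t)"
  using polynomial_path_on_scaleR[OF assms] by simp

lemma polynomial_path_on_const: "polynomial_path_on T d (\<lambda>t. a)"
  by (rule polynomial_path_on_mono[of _ 0]) (auto simp: polynomial_path_on_def)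

lemma polynomial_path_on_power:
  fixes u :: "real \<Rightarrow> real"
  assumes "polynomial_path_on T d u"
  shows "polynomial_path_on T (n * d) (\<lambda>t. u t ^ n)"
  by (induction n) (use assms in \<open>auto intro!: polynomial_path_on_const polynomial_path_on_mult\<close>)

lemma polynomial_path_on_prod:
  fixes u :: "'i \<Rightarrow> real \<Rightarrow> real"
  assumes "\<And>i. i \<in> I \<Longrightarrow> polynomial_path_on T (d i) (u i)"
  shows "polynomial_path_on T (sum d I) (\<lambda>t. \<Prod>i\<in>I. u i t)"
  using assms
  by (induction I rule: infinite_finite_induct)
    (auto intro!: polynomial_path_on_const polynomial_path_on_mult)

lemma polynomial_path_on_vec:
  fixes u :: "real \<Rightarrow> real ^ 'n"
  assumes "\<And>i. polynomial_path_on T d (\<lambda>t. u t $ i)"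
  shows "polynomial_path_on T d u"
proof -
  have "polynomial_path_on T d (\<lambda>t. \<Sum>i\<in>UNIV. u t $ i *\<^sub>R axis i (1::real))"
    by (intro polynomial_path_on_sum polynomial_path_on_linear[of "\<lambda>r. r *\<^sub>R axis _ (1::real)"] assms)
      (auto intro!: linearI simp: scaleR_add_left)
  then show ?thesis
    by (simp add: basis_expansion scalar_mult_eq_scaleR[symmetric])
qed

lemma polynomial_path_on_Pair:
  assumes "polynomial_path_on T d u" and "polynomial_path_on T d v"
  shows "polynomial_path_on T d (\<lambda>t. (u t, v t))"
proof -
  obtain a b where "\<And>t. t \<in> T \<Longrightarrow> u t = (\<Sum>i\<le>d. t ^ i *\<^sub>R a i)"
    "\<And>t. t \<in> T \<Longrightarrow> v t = (\<Sum>i\<le>d. t ^ i *\<^sub>R b i)"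
    using assms by (auto simp: polynomial_path_on_def)
  then show ?thesis
    unfolding polynomial_path_on_def
    by (intro exI[of _ "\<lambda>i. (a i, b i)"]) (simp add: sum_prod)
qed

text \<open>The powers of \<open>h\<close> are absorbed into the coefficients. The sign of
  \<open>h\<close> matters because \<open>u\<close> is known to be polynomial only on
  \<open>{0..h}\<close>, so \<open>t * h\<close> must stay there.\<close>

lemma polynomial_path_on_rescale:
  assumes "polynomial_path_on {0..h} d u" and "h \<ge> 0"
  shows "polynomial_path_on {0..1} d (\<lambda>t. u (t * h))"
proof -
  obtain a where "\<And>t. t \<in> {0..h} \<Longrightarrow> u t = (\<Sum>i\<le>d. t ^ i *\<^sub>R a i)"
    using assms(1) by (auto simp: polynomial_path_on_def)
  moreover have "t * h \<in> {0..h}" if "t \<in> {0..1}" for t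
    using that \<open>h \<ge> 0\<close> by (auto intro: mult_left_le_one_le)
  ultimately show ?thesis
    unfolding polynomial_path_on_def
    by (intro exI[of _ "\<lambda>i. h ^ i *\<^sub>R a i"]) (simp add: power_mult_distrib)
qed

text \<open>Integral and quadrature are both linear in the vector coefficients, so exactness for the
  scalar monomials of degree at most \<open>d\<close> suffices.\<close>

lemma gauss_legendre_exact_path:
  fixes u :: "real \<Rightarrow> 'a::real_normed_vector"
  assumes "orthonormal_legendre P" and gl: "gauss_legendre P k c b"
    and "polynomial_path_on {0..1} d u" and "d < 2 * k"
  shows "(u has_integral quadrature k c b u) {0..1}"
proof -
  obtain a where a: "\<And>t. t \<in> {0..1} \<Longrightarrow> u t = (\<Sum>i\<le>d. t ^ i *\<^sub>R a i)"
    using assms(3) by (auto simp: polynomial_path_on_def)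
  have "((\<lambda>t. \<Sum>i\<le>d. poly (monom 1 i) t *\<^sub>R a i) has_integral
      (\<Sum>i\<le>d. quadrature k c b (poly (monom 1 i)) *\<^sub>R a i)) {0..1}"
  proof (intro has_integral_sum has_integral_scaleR_left gauss_legendre_exact[OF assms(1) gl])
    fix i assume "i \<in> {..d}"
    then show "degree (monom (1::real) i) < 2 * k"
      using \<open>d < 2 * k\<close> by (simp add: degree_monom_eq)
  qed simp
  moreover have "(\<Sum>i\<le>d. quadrature k c b (poly (monom 1 i)) *\<^sub>R a i) =
      (\<Sum>l=1..k. \<Sum>i\<le>d. (b l * c l ^ i) *\<^sub>R a i)"
    by (subst sum.swap) (simp add: quadrature_def poly_monom scaleR_sum_left)
  \<comment> \<open>The nodes lie in \<open>{0..1}\<close>, the interval on which the coefficients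
    \<open>a\<close> describe \<open>u\<close>.\<close>
  moreover have "\<dots> = quadrature k c b u"
    using gl by (simp add: quadrature_def gauss_legendre_def a scaleR_sum_right)
  ultimately have "((\<lambda>t. \<Sum>i\<le>d. t ^ i *\<^sub>R a i) has_integral quadrature k c b u) {0..1}"
    by (simp add: poly_monom)
  then show ?thesis
    by (rule has_integral_eq[rotated]) (simp add: a)
qed

section \<open>Gradients\<close>

text \<open>\<open>grad\<close> is a definite description and becomes usable through uniqueness: two
  gradients induce the same linear functional, and evaluating it at their difference
  \<open>E - D\<close> shows that this difference is zero.\<close>

lemma grad_eqI:
  assumes "GDERIV F x :> D"
  shows "grad F x = D"
  unfolding grad_def
proof (rule the_equality)
  fix E assume "GDERIV F x :> E"
  then have "(\<lambda>v. v \<bullet> E) = (\<lambda>v. v \<bullet> D)"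
    using assms unfolding gderiv_def by (rule has_derivative_unique)
  then have "v \<bullet> E = v \<bullet> D" for v
    by (rule fun_cong)
  then have "(E - D) \<bullet> (E - D) = 0"
    by (simp only: inner_diff_right)
  then show "E = D" by simp
qed fact

text \<open>The explicit form serves the later degree count. For \<open>\<kappa> i = 0\<close> the
  truncated exponent \<open>\<kappa> i - 1\<close> does no harm, since the factor
  \<open>real (\<kappa> i)\<close> is zero.\<close>

lemma polynomial_GDERIV:
  fixes a :: "('n::finite \<Rightarrow> nat) \<Rightarrow> real"
  shows "GDERIV (\<lambda>x::real^'n. \<Sum>\<kappa>\<in>K. a \<kappa> * (\<Prod>i\<in>UNIV. (x $ i) ^ \<kappa> i)) x :>
    (\<chi> i. \<Sum>\<kappa>\<in>K. a \<kappa> * (real (\<kappa> i) * (x $ i) ^ (\<kappa> i - 1) * (\<Prod>j\<in>UNIV - {i}. (x $ j) ^ \<kappa> j)))"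
proof -
  have coord: "((\<lambda>x::real^'n. x $ i) has_derivative (\<lambda>v. v $ i)) (at x)" for i
    by (intro bounded_linear.has_derivative[OF bounded_linear_vec_nth] has_derivative_ident)
  have "((\<lambda>x::real^'n. \<Sum>\<kappa>\<in>K. a \<kappa> * (\<Prod>i\<in>UNIV. (x $ i) ^ \<kappa> i)) has_derivative
      (\<lambda>v. \<Sum>\<kappa>\<in>K. a \<kappa> * (\<Sum>i\<in>UNIV. real (\<kappa> i) * v $ i * (x $ i) ^ (\<kappa> i - 1) *
        (\<Prod>j\<in>UNIV - {i}. (x $ j) ^ \<kappa> j)))) (at x)"
    by (intro has_derivative_sum has_derivative_mult_right has_derivative_prod
        has_derivative_power coord)
  also have "(\<lambda>v::real^'n. \<Sum>\<kappa>\<in>K. a \<kappa> * (\<Sum>i\<in>UNIV. real (\<kappa> i) * v $ i * (x $ i) ^ (\<kappa> i - 1) *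
        (\<Prod>j\<in>UNIV - {i}. (x $ j) ^ \<kappa> j))) =
      (\<lambda>v. v \<bullet> (\<chi> i. \<Sum>\<kappa>\<in>K. a \<kappa> * (real (\<kappa> i) * (x $ i) ^ (\<kappa> i - 1) *
        (\<Prod>j\<in>UNIV - {i}. (x $ j) ^ \<kappa> j))))"
    unfolding inner_vec_def sum_distrib_left vec_lambda_beta inner_real_def
    by (subst sum.swap) (simp add: ac_simps)
  finally show ?thesis unfolding gderiv_def .
qed

lemma polynomial_has_gradient:
  assumes "polynomial_of_degree_le d g"
  shows "GDERIV g x :> grad g x"
proof -
  obtain a where "\<And>x. g x = (\<Sum>\<kappa> | (\<Sum>i\<in>UNIV. \<kappa> i) \<le> d. a \<kappa> * (\<Prod>i\<in>UNIV. (x $ i) ^ \<kappa> i))"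
    using assms by (auto simp: polynomial_of_degree_le_def)
  then have g: "g = (\<lambda>x. \<Sum>\<kappa> | (\<Sum>i\<in>UNIV. \<kappa> i) \<le> d. a \<kappa> * (\<Prod>i\<in>UNIV. (x $ i) ^ \<kappa> i))" by auto
  show ?thesis
    unfolding g grad_eqI[OF polynomial_GDERIV] by (rule polynomial_GDERIV)
qed

text \<open>Each partial derivative lowers the total degree by one, and substituting coordinates of
  degree \<open>s\<close> multiplies every exponent by \<open>s\<close>.\<close>

lemma polynomial_path_on_grad:
  assumes "polynomial_of_degree_le d g" and u: "polynomial_path_on T s u"
  shows "polynomial_path_on T ((d - 1) * s) (\<lambda>t. grad g (u t))"
proof (rule polynomial_path_on_vec)
  fix i
  obtain a where "\<And>x. g x = (\<Sum>\<kappa> | (\<Sum>i\<in>UNIV. \<kappa> i) \<le> d. a \<kappa> * (\<Prod>i\<in>UNIV. (x $ i) ^ \<kappa> i))"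
    using assms(1) by (auto simp: polynomial_of_degree_le_def)
  then have g: "g = (\<lambda>x. \<Sum>\<kappa> | (\<Sum>i\<in>UNIV. \<kappa> i) \<le> d. a \<kappa> * (\<Prod>i\<in>UNIV. (x $ i) ^ \<kappa> i))" by auto
  have coord: "polynomial_path_on T s (\<lambda>t. u t $ j)" for j
    by (rule polynomial_path_on_linear[OF _ u]) (rule bounded_linear.linear[OF bounded_linear_vec_nth])
  have "polynomial_path_on T ((d - 1) * s)
      (\<lambda>t. a \<kappa> * (real (\<kappa> i) * (u t $ i) ^ (\<kappa> i - 1) * (\<Prod>j\<in>UNIV - {i}. (u t $ j) ^ \<kappa> j)))"
    if "(\<Sum>i\<in>UNIV. \<kappa> i) \<le> d" for \<kappa>
  \<comment> \<open>If the variable does not occur, the exponent count loses no unit, but the whole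
    term is zero.\<close>
  proof (cases "\<kappa> i = 0")
    case True
    then show ?thesis by (simp add: polynomial_path_on_const)
  next
    case False
    \<comment> \<open>The degree mirrors the nesting of the products; the two zeros belong to the
      constants \<open>a \<kappa>\<close> and \<open>real (\<kappa> i)\<close>.\<close>
    have "polynomial_path_on T (0 + (0 + (\<kappa> i - 1) * s + (\<Sum>j\<in>UNIV - {i}. \<kappa> j * s)))
      (\<lambda>t. a \<kappa> * (real (\<kappa> i) * (u t $ i) ^ (\<kappa> i - 1) * (\<Prod>j\<in>UNIV - {i}. (u t $ j) ^ \<kappa> j)))"
      by (intro polynomial_path_on_mult polynomial_path_on_prod polynomial_path_on_power
          polynomial_path_on_const coord)
    moreover have "\<kappa> i - 1 + (\<Sum>j\<in>UNIV - {i}. \<kappa> j) \<le> d - 1"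
      using that False sum.remove[of UNIV i \<kappa>] by simp
    then have "0 + (0 + (\<kappa> i - 1) * s + (\<Sum>j\<in>UNIV - {i}. \<kappa> j * s)) \<le> (d - 1) * s"
      by (simp only: sum_distrib_right[symmetric] add_0 distrib_right[symmetric] mult_le_mono1)
    ultimately show ?thesis by (rule polynomial_path_on_mono)
  qed
  then have "polynomial_path_on T ((d - 1) * s) (\<lambda>t. \<Sum>\<kappa> | (\<Sum>i\<in>UNIV. \<kappa> i) \<le> d.
      a \<kappa> * (real (\<kappa> i) * (u t $ i) ^ (\<kappa> i - 1) * (\<Prod>j\<in>UNIV - {i}. (u t $ j) ^ \<kappa> j)))"
    by (intro polynomial_path_on_sum) simp
  then show "polynomial_path_on T ((d - 1) * s) (\<lambda>t. grad g (u t) $ i)"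
    unfolding g grad_eqI[OF polynomial_GDERIV] by simp
qed

lemma aug_H_GDERIV:
  assumes "GDERIV g (fst y) :> D"
  shows "GDERIV (aug_H g Hbar) y :> (D, -1)"
proof -
  have "((\<lambda>y. g (fst y) - snd y + Hbar) has_derivative (\<lambda>v. fst v \<bullet> D - snd v + 0)) (at y)"
    using assms unfolding gderiv_def
    by (intro has_derivative_add has_derivative_diff has_derivative_const has_derivative_snd
        has_derivative_compose[OF has_derivative_fst, of _ _ _ _ g] has_derivative_ident) auto
  then show ?thesis
    unfolding gderiv_def aug_H_def[abs_def] by (simp add: inner_prod_def)
qed

section \<open>Energy conservation\<close>

text \<open>Up to a common scalar, \<open>aug_B\<close> is a rank-one map minus its transpose, so
  exchanging \<open>v\<close> and \<open>w\<close> exchanges the two terms.\<close>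

lemma aug_B_skew: "v \<bullet> aug_B f g Hbar y w = - (w \<bullet> aug_B f g Hbar y v)"
  by (simp add: aug_B_def inner_diff_right inner_commute algebra_simps)

text \<open>The weight \<open>P i * P j\<close> is symmetric, so the indices may be exchanged along
  with the vectors; in this form the numbers
  \<open>\<gamma> i \<bullet> \<rho> i j (\<gamma> j)\<close> are skew in \<open>i\<close> and
  \<open>j\<close>.\<close>

lemma rho_hat_skew:
  "v \<bullet> rho_hat P k c b f g Hbar h u i j w = - (w \<bullet> rho_hat P k c b f g Hbar h u j i v)"
  unfolding rho_hat_def quadrature_def inner_sum_right inner_scaleR_right sum_negf[symmetric]
  by (subst aug_B_skew) (simp add: mult.commute)

text \<open>Exchanging the order of summation shows that the sum equals its own negative.\<close>

lemma sum_skew_eq_0: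
  fixes a :: "'i \<Rightarrow> 'i \<Rightarrow> real"
  assumes "\<And>i j. a i j = - a j i"
  shows "(\<Sum>i\<in>I. \<Sum>j\<in>I. a i j) = 0"
proof -
  have "(\<Sum>i\<in>I. \<Sum>j\<in>I. a i j) = (\<Sum>i\<in>I. \<Sum>j\<in>I. - a j i)"
    using assms by (intro sum.cong refl)
  also have "\<dots> = - (\<Sum>i\<in>I. \<Sum>j\<in>I. a i j)"
    by (subst sum.swap) (simp add: sum_negf)
  finally show ?thesis by simp
qed

theorem theorem5:
  fixes f :: "real ^ 'n \<Rightarrow> real ^ 'n" and g :: "real ^ 'n \<Rightarrow> real"
    and s k \<nu> :: nat and h Hbar \<alpha> :: real
    and P :: "nat \<Rightarrow> real poly" and c b :: "nat \<Rightarrow> real"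
    and y0 y1 :: "(real ^ 'n) \<times> real" and u :: "real \<Rightarrow> (real ^ 'n) \<times> real"
  assumes "s \<ge> 1" and "k \<ge> 1" and "\<nu> \<ge> 1" and "h > 0" and "Hbar > 0"
    and "continuously_differentiable f"
    and "polynomial_of_degree_le \<nu> g"
    and "real \<nu> \<le> 2 * real k / real s"
    and "orthonormal_legendre P"
    and "gauss_legendre P k c b"
    and "ephbvm_step P k s c b f g Hbar h y0 u \<alpha>"
    and "y1 = u h"
  shows "((\<lambda>\<xi>. grad g (fst (u (\<xi> * h)))) has_integral g_hat0 k c b g h u) {0..1} \<and>
         (\<forall>j<s. ((\<lambda>\<xi>. poly (P j) \<xi> *\<^sub>R grad (aug_H g Hbar) (u (\<xi> * h)))
                   has_integral gamma_hat P k c b g Hbar h u j) {0..1}) \<and>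
         aug_H g Hbar y1 = aug_H g Hbar y0"
proof -
  define gH where "gH \<xi> = grad (aug_H g Hbar) (u (\<xi> * h))" for \<xi>
  define \<gamma> where "\<gamma> = gamma_hat P k c b g Hbar h u"
  define \<rho> where "\<rho> = rho_hat P k c b f g Hbar h u"
  define g0 where "g0 = g_hat0 k c b g h u"
  define d0 where "d0 = d_hat0 k c b g h u"
  have step: "polynomial_path_on {0..h} s u" "g0 \<noteq> 0" "u 0 = y0"
    and ode: "\<And>\<xi>. \<xi> \<in> {0..1} \<Longrightarrow> (u has_vector_derivative
      (\<Sum>i<s. \<Sum>j<s. poly (P i) \<xi> *\<^sub>R \<rho> i j (\<gamma> j)) - \<alpha> *\<^sub>R (d0, 1)) (at (\<xi> * h) within {0..h})"
    using assms(11) by (auto simp: ephbvm_step_def \<gamma>_def \<rho>_def g0_def d0_def)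
  have degP: "degree (P i) = i" and P0: "P 0 = 1" for i
    using assms(9) unfolding orthonormal_legendre_def by blast+
  have "real (\<nu> * s) \<le> real (2 * k)"
    using assms(1,8) by (simp add: field_simps)
  then have "\<nu> * s \<le> 2 * k"
    by (simp only: of_nat_le_iff)
  \<comment> \<open>Here \<open>\<nu> \<ge> 1\<close> keeps the subtraction from truncating; the
    strict \<open>j < s\<close> then gives the strict bound that exactness requires.\<close>
  moreover have "(\<nu> - 1) * s + s = \<nu> * s"
    using assms(3) by (cases \<nu>) auto
  ultimately have deg: "(\<nu> - 1) * s + j < 2 * k" if "j < s" for j
    using that by linarith
  have grad_H: "grad (aug_H g Hbar) y = (grad g (fst y), -1)" for y
    by (rule grad_eqI[OF aug_H_GDERIV[OF polynomial_has_gradient[OF assms(7)]]])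
  have path: "polynomial_path_on {0..1} s (\<lambda>\<xi>. fst (u (\<xi> * h)))"
    using polynomial_path_on_rescale[OF step(1)] assms(4)
    by (intro polynomial_path_on_linear[OF linear_fst]) simp
  have grad_path: "polynomial_path_on {0..1} ((\<nu> - 1) * s) (\<lambda>\<xi>. grad g (fst (u (\<xi> * h))))"
    by (rule polynomial_path_on_grad[OF assms(7) path])
  have int_g: "((\<lambda>\<xi>. grad g (fst (u (\<xi> * h)))) has_integral g0) {0..1}"
    unfolding g0_def g_hat0_def
    using gauss_legendre_exact_path[OF assms(9,10) grad_path] deg[of 0] assms(1) by simp
  have int_\<gamma>: "((\<lambda>\<xi>. poly (P j) \<xi> *\<^sub>R gH \<xi>) has_integral \<gamma> j) {0..1}" if "j < s" for j
  proof -
    \<comment> \<open>The last component of \<open>gH\<close> is the constant \<open>-1\<close>,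
      which fits any degree bound, so the bound for \<open>grad g\<close> carries over to the
      pair.\<close>
    have "polynomial_path_on {0..1} (j + (\<nu> - 1) * s) (\<lambda>\<xi>. poly (P j) \<xi> *\<^sub>R gH \<xi>)"
      unfolding gH_def grad_H using polynomial_path_on_poly[of _ "P j"] degP
      by (intro polynomial_path_on_scaleR polynomial_path_on_Pair grad_path polynomial_path_on_const)
        simp
    from gauss_legendre_exact_path[OF assms(9,10) this] show ?thesis
      using deg[OF that] by (simp add: \<gamma>_def gamma_hat_def gH_def add.commute)
  qed
  define dH where "dH = (\<lambda>\<xi>. gH \<xi> \<bullet> ((\<Sum>i<s. \<Sum>j<s. poly (P i) \<xi> *\<^sub>R \<rho> i j (\<gamma> j)) - \<alpha> *\<^sub>R (d0, 1)))"
  \<comment> \<open>By the chain rule \<open>h * dH \<xi>\<close> is the derivative of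
    \<open>aug_H g Hbar (u (\<xi> * h))\<close>. The endpoints are kept as \<open>1 * h\<close> and
    \<open>0 * h\<close> to match this function of \<open>\<xi>\<close>.\<close>
  have "((\<lambda>\<xi>. h * dH \<xi>) has_integral aug_H g Hbar (u (1 * h)) - aug_H g Hbar (u (0 * h))) {0..1}"
  proof (rule fundamental_theorem_of_calculus)
    fix \<xi> :: real assume \<xi>: "\<xi> \<in> {0..1}"
    \<comment> \<open>The derivative of \<open>u\<close> is given only within \<open>{0..h}\<close>,
      one-sided at the ends, so the chain rule must stay inside this interval.\<close>
    have sub: "(\<lambda>\<xi>. \<xi> * h) ` {0..1} \<subseteq> {0..h}"
      using assms(4) by (auto intro: mult_left_le_one_le)
    have "((\<lambda>\<xi>. \<xi> * h) has_vector_derivative h) (at \<xi> within {0..1})"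
      by (auto intro!: derivative_eq_intros)
    from vector_diff_chain_within[OF this has_vector_derivative_within_subset[OF ode[OF \<xi>] sub]]
    have du: "((\<lambda>\<xi>. u (\<xi> * h)) has_vector_derivative
        h *\<^sub>R ((\<Sum>i<s. \<Sum>j<s. poly (P i) \<xi> *\<^sub>R \<rho> i j (\<gamma> j)) - \<alpha> *\<^sub>R (d0, 1))) (at \<xi> within {0..1})"
      by (simp add: o_def)
    have "(aug_H g Hbar has_derivative (\<lambda>v. v \<bullet> gH \<xi>)) (at (u (\<xi> * h)))"
      using aug_H_GDERIV[OF polynomial_has_gradient[OF assms(7)]]
      unfolding gderiv_def gH_def grad_H .
    from has_derivative_compose[OF du[unfolded has_vector_derivative_def] this]
    show "((\<lambda>\<xi>. aug_H g Hbar (u (\<xi> * h))) has_vector_derivative h * dH \<xi>) (at \<xi> within {0..1})"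
      unfolding has_vector_derivative_def dH_def by (simp add: inner_commute mult.assoc)
  qed simp
  moreover have "((\<lambda>\<xi>. h * dH \<xi>) has_integral h * ((\<Sum>i<s. \<Sum>j<s. \<gamma> i \<bullet> \<rho> i j (\<gamma> j)) -
      \<alpha> * (\<gamma> 0 \<bullet> (d0, 1)))) {0..1}"
  proof -
    \<comment> \<open>The factor \<open>P 0 = 1\<close> is inserted in the \<open>\<alpha>\<close>
      term, so that every occurrence of \<open>gH\<close> has the form whose integral is some
      \<open>\<gamma> i\<close> with \<open>i < s\<close>.\<close>
    have "((\<lambda>\<xi>. (\<Sum>i<s. \<Sum>j<s. (poly (P i) \<xi> *\<^sub>R gH \<xi>) \<bullet> \<rho> i j (\<gamma> j)) -
        \<alpha> * ((poly (P 0) \<xi> *\<^sub>R gH \<xi>) \<bullet> (d0, 1))) has_integral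
      (\<Sum>i<s. \<Sum>j<s. \<gamma> i \<bullet> \<rho> i j (\<gamma> j)) - \<alpha> * (\<gamma> 0 \<bullet> (d0, 1))) {0..1}"
      using assms(1) int_\<gamma>
      by (intro has_integral_diff has_integral_sum has_integral_mult_right
          has_integral_linear[OF _ bounded_linear_inner_left, unfolded o_def]) auto
    moreover have "(\<Sum>i<s. \<Sum>j<s. (poly (P i) \<xi> *\<^sub>R gH \<xi>) \<bullet> \<rho> i j (\<gamma> j)) -
        \<alpha> * ((poly (P 0) \<xi> *\<^sub>R gH \<xi>) \<bullet> (d0, 1)) = dH \<xi>" for \<xi>
      by (simp only: dH_def P0 poly_1 scaleR_one inner_diff_right inner_sum_right inner_scaleR_left
          inner_scaleR_right)
    ultimately show ?thesis by (intro has_integral_mult_right) simp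
  qed
  ultimately have "aug_H g Hbar (u (1 * h)) - aug_H g Hbar (u (0 * h)) =
      h * ((\<Sum>i<s. \<Sum>j<s. \<gamma> i \<bullet> \<rho> i j (\<gamma> j)) - \<alpha> * (\<gamma> 0 \<bullet> (d0, 1)))"
    by (rule has_integral_unique)
  moreover have "(\<Sum>i<s. \<Sum>j<s. \<gamma> i \<bullet> \<rho> i j (\<gamma> j)) = 0"
    unfolding \<rho>_def by (intro sum_skew_eq_0 rho_hat_skew)
  moreover have "\<gamma> 0 \<bullet> (d0, 1) = 0"
  proof -
    \<comment> \<open>Both sides of
      \<open>\<gamma> 0 \<bullet> (d0, 1) = g0 \<bullet> d0 - 1\<close> are integrals of the same
      function, since \<open>gH\<close> has last component \<open>-1\<close>; uniqueness of the
      integral replaces a computation of the sum of the weights.\<close>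
    have "((\<lambda>\<xi>. gH \<xi> \<bullet> (d0, 1)) has_integral \<gamma> 0 \<bullet> (d0, 1)) {0..1}"
      using has_integral_linear[OF int_\<gamma>[of 0] bounded_linear_inner_left, of "(d0, 1)"] assms(1)
      by (simp add: o_def P0)
    moreover have "((\<lambda>\<xi>. grad g (fst (u (\<xi> * h))) \<bullet> d0 - 1) has_integral g0 \<bullet> d0 - 1) {0..1}"
      using has_integral_linear[OF int_g bounded_linear_inner_left, of d0]
        has_integral_const_real[of "1::real" 0 1]
      by (intro has_integral_diff) (simp_all add: o_def)
    ultimately have "\<gamma> 0 \<bullet> (d0, 1) = g0 \<bullet> d0 - 1"
      by (simp add: gH_def grad_H inner_prod_def has_integral_unique)
    \<comment> \<open>This rests on \<open>g0 \<noteq> 0\<close>: for \<open>g0 = 0\<close> the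
      value \<open>inverse 0 = 0\<close> would give \<open>d0 = 0\<close>.\<close>
    also have "g0 \<bullet> d0 = 1"
      using step(2) unfolding d0_def d_hat0_def g0_def[symmetric] by (simp add: dot_square_norm)
    finally show ?thesis by simp
  qed
  ultimately show ?thesis
    using int_g int_\<gamma> assms(12) step(3) by (simp add: g0_def \<gamma>_def gH_def)
qed

end
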